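(* Fix an integer $d>1$. The number of inequivalent harmonic frames for $\mathbb{C}^d$ with $N$ elements, $N$ ranging over prime numbers with $N>d$, is $O(N^{d-1})$; that is, there is a constant $C_d$ depending only on $d$ such that for every prime $N>d$ this number is at most $C_dN^{d-1}$.
   Context: Let $G$ be a finite abelian group of order $N$ with characters $\xi_1,\ldots,\xi_N$ (the $N$ group homomorphisms $G\to\mathbb{C}^\times$), let $J\subseteq\{1,\ldots,N\}$ with $|J|=d$, and let $U:\mathbb{C}^{d}\to\mathbb{C}^{d}$ be unitary. The set of vectors $\Phi=U\{(\xi_j(g))_{j\in J}: g\in G\}\subset\mathbb{C}^{d}$ is called a harmonic frame for $\mathbb{C}^d$ (with $N$ elements). Two harmonic frames $\Phi,\Psi\subset\mathbb{C}^d$ with $N$ elements are equivalent if there is a unitary transformation $V$ of $\mathbb{C}^d$ with $\Phi=V\Psi$ as sets; the number of inequivalent harmonic frames is the number of equivalence classes. *)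

theory Defs
  imports "HOL-Analysis.Analysis" "HOL-Algebra.Coset"
begin

definition complex_units :: "complex monoid" where
  "complex_units = \<lparr>carrier = UNIV - {0}, monoid.mult = (*), one = 1\<rparr>"

(* Extensionality makes two characters equal as HOL functions exactly when they agree on the
   carrier, so that the number of characters is counted correctly. *)
definition characters :: "('a, 'b) monoid_scheme \<Rightarrow> ('a \<Rightarrow> complex) set" where
  "characters G = hom G complex_units \<inter> extensional (carrier G)"

definition adjoint_matrix :: "complex^'n^'m \<Rightarrow> complex^'m^'n" where
  "adjoint_matrix A = (\<chi> i j. cnj (A $ j $ i))"

definition unitary_matrix :: "complex^'n^'n \<Rightarrow> bool" where
  "unitary_matrix U \<longleftrightarrow> adjoint_matrix U ** U = mat 1 \<and> U ** adjoint_matrix U = mat 1"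

(* The index set J of the chosen characters is represented by the set of those characters; xi is an
   enumeration of it by the coordinates of C^d, i.e. the identification of C^J with C^d. *)
definition harmonic_frame_of :: "('a, 'b) monoid_scheme \<Rightarrow> (complex^'d) set \<Rightarrow> bool" where
  "harmonic_frame_of G \<Phi> \<longleftrightarrow>
     (\<exists>J \<xi> U. J \<subseteq> characters G \<and> card J = CARD('d) \<and> bij_betw \<xi> (UNIV :: 'd set) J \<and>
        unitary_matrix U \<and> \<Phi> = (\<lambda>v. U *v v) ` {(\<chi> j. \<xi> j g) | g. g \<in> carrier G})"

(* Groups carried by natural numbers represent every finite group up to isomorphism; that nothing is
   lost is harmonic_frame_of_imp_harmonic_frame below. *)
definition harmonic_frames :: "nat \<Rightarrow> (complex^'d) set set" where
  "harmonic_frames N =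
     {\<Phi>. \<exists>G :: nat monoid. comm_group G \<and> finite (carrier G) \<and> order G = N \<and>
          harmonic_frame_of G \<Phi>}"

definition frame_equiv :: "nat \<Rightarrow> ((complex^'d) set \<times> (complex^'d) set) set" where
  "frame_equiv N = {(\<Phi>, \<Psi>). \<Phi> \<in> harmonic_frames N \<and> \<Psi> \<in> harmonic_frames N \<and>
     (\<exists>V. unitary_matrix V \<and> \<Phi> = (\<lambda>v. V *v v) ` \<Psi>)}"

lemma harmonic_frame_of_imp_harmonic_frame:
  fixes G :: "('a, 'b) monoid_scheme" and \<Phi> :: "(complex^'d) set"
  assumes "comm_group G" "finite (carrier G)" "order G = N" "harmonic_frame_of G \<Phi>"
  shows "\<Phi> \<in> harmonic_frames N"
proof -
  interpret comm_group G by fact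
  obtain f where f: "bij_betw f {0..<N} (carrier G)"
    using ex_bij_betw_nat_finite[OF assms(2)] assms(3) by (auto simp: order_def)
  define h where "h = inv_into {0..<N} f"
  have h: "bij_betw h (carrier G) {0..<N}"
    unfolding h_def using f by (rule bij_betw_inv_into)
  have fh: "f (h x) = x" if "x \<in> carrier G" for x
    unfolding h_def using f that by (simp add: bij_betw_inv_into_right)
  have hf: "h (f n) = n" if "n < N" for n
    unfolding h_def using f that by (simp add: bij_betw_inv_into_left)
  have fc: "f n \<in> carrier G" if "n < N" for n
    using f that by (auto simp: bij_betw_def)
  have hc: "h x < N" if "x \<in> carrier G" for x
    using h that by (auto simp: bij_betw_def)
  define H :: "nat monoid" where
    "H = \<lparr>carrier = {0..<N}, monoid.mult = (\<lambda>m n. h (f m \<otimes>\<^bsub>G\<^esub> f n)), one = h \<one>\<^bsub>G\<^esub>\<rparr>"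
  have H: "comm_group H"
  proof (rule comm_groupI)
    fix x assume "x \<in> carrier H"
    then have x: "x < N" by (simp add: H_def)
    show "\<exists>y\<in>carrier H. y \<otimes>\<^bsub>H\<^esub> x = \<one>\<^bsub>H\<^esub>"
      using x by (intro bexI[of _ "h (inv\<^bsub>G\<^esub> f x)"]) (auto simp: H_def fh fc hc)
  qed (auto simp: H_def fh hf fc hc m_ac)
  obtain J \<xi> U where J: "J \<subseteq> characters G" "card J = CARD('d)" "bij_betw \<xi> (UNIV :: 'd set) J"
    "unitary_matrix U" "\<Phi> = (\<lambda>v. U *v v) ` {(\<chi> j. \<xi> j g) | g. g \<in> carrier G}"
    using assms(4) by (auto simp: harmonic_frame_of_def)
  define T :: "('a \<Rightarrow> complex) \<Rightarrow> nat \<Rightarrow> complex"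
    where "T = (\<lambda>c. restrict (c \<circ> f) {0..<N})"
  have inj: "inj_on T (characters G)"
  proof (rule inj_onI)
    fix c c' assume c: "c \<in> characters G" "c' \<in> characters G" and eq: "T c = T c'"
    have "c x = c' x" if "x \<in> carrier G" for x
      using fun_cong[OF eq, of "h x"] that by (simp add: T_def hc fh)
    with c show "c = c'" by (auto simp: characters_def intro: extensionalityI)
  qed
  have T: "T c \<in> characters H" if "c \<in> characters G" for c
    using that fc
    by (auto simp: T_def characters_def hom_def complex_units_def H_def Pi_iff fh hc)
  have "{(\<chi> j. \<xi> j g) | g. g \<in> carrier G} = {(\<chi> j. T (\<xi> j) n) | n. n \<in> carrier H}"
    (is "?A = ?B")
  proof
    show "?A \<subseteq> ?B"
    proof clarify
      fix g assume "g \<in> carrier G"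
      then show "\<exists>n. (\<chi> j. \<xi> j g) = (\<chi> j. T (\<xi> j) n) \<and> n \<in> carrier H"
        by (intro exI[of _ "h g"]) (simp add: T_def H_def fh hc)
    qed
    show "?B \<subseteq> ?A"
    proof clarify
      fix n assume "n \<in> carrier H"
      then show "\<exists>g. (\<chi> j. T (\<xi> j) n) = (\<chi> j. \<xi> j g) \<and> g \<in> carrier G"
        by (intro exI[of _ "f n"]) (simp add: T_def H_def fc)
    qed
  qed
  moreover have "bij_betw (T \<circ> \<xi>) UNIV (T ` J)" "card (T ` J) = CARD('d)"
    using J(1-3) inj_on_subset[OF inj J(1)]
    by (auto simp: card_image intro!: bij_betw_trans inj_on_imp_bij_betw)
  ultimately have "harmonic_frame_of H \<Phi>"
    unfolding harmonic_frame_of_def using J T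
    by (intro exI[of _ "T ` J"] exI[of _ "T \<circ> \<xi>"] exI[of _ U]) auto
  with H show ?thesis
    unfolding harmonic_frames_def by (auto simp: order_def H_def)
qed

lemma adjoint_matrix_mult: "adjoint_matrix (A ** B) = adjoint_matrix B ** adjoint_matrix A"
  by (simp add: adjoint_matrix_def matrix_matrix_mult_def vec_eq_iff mult.commute)

lemma unitary_matrix_mult:
  assumes "unitary_matrix A" "unitary_matrix B"
  shows "unitary_matrix (A ** B)"
  using assms unfolding unitary_matrix_def adjoint_matrix_mult
  by (metis matrix_mul_assoc matrix_mul_lid)

lemma unitary_matrix_adjoint: "unitary_matrix A \<Longrightarrow> unitary_matrix (adjoint_matrix A)"
  by (auto simp: unitary_matrix_def adjoint_matrix_def)

lemma unitary_matrix_one: "unitary_matrix (mat 1)"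
proof -
  have "adjoint_matrix (mat 1) = (mat 1 :: complex^'n^'n)"
    by (simp add: adjoint_matrix_def mat_def vec_eq_iff)
  then show ?thesis by (simp add: unitary_matrix_def)
qed

lemma equiv_frame_equiv: "equiv (harmonic_frames N :: (complex^'d) set set) (frame_equiv N)"
proof (rule equivI)
  show "frame_equiv N \<subseteq> harmonic_frames N \<times> (harmonic_frames N :: (complex^'d) set set)"
    by (auto simp: frame_equiv_def)
  show "refl_on (harmonic_frames N :: (complex^'d) set set) (frame_equiv N)"
    using unitary_matrix_one by (force simp: refl_on_def frame_equiv_def)
  show "sym (frame_equiv N :: ((complex^'d) set \<times> (complex^'d) set) set)"
  proof (rule symI)
    fix \<Phi> \<Psi> :: "(complex^'d) set" assume "(\<Phi>, \<Psi>) \<in> frame_equiv N"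
    then obtain V where "\<Phi> \<in> harmonic_frames N" "\<Psi> \<in> harmonic_frames N"
      "unitary_matrix V" "\<Phi> = (\<lambda>v. V *v v) ` \<Psi>"
      by (auto simp: frame_equiv_def)
    moreover from this have "\<Psi> = (\<lambda>v. adjoint_matrix V *v v) ` \<Phi>"
      by (simp add: image_image matrix_vector_mul_assoc unitary_matrix_def)
    ultimately show "(\<Psi>, \<Phi>) \<in> frame_equiv N"
      using unitary_matrix_adjoint unfolding frame_equiv_def by blast
  qed
  show "trans (frame_equiv N :: ((complex^'d) set \<times> (complex^'d) set) set)"
  proof (rule transI)
    fix \<Phi> \<Psi> X :: "(complex^'d) set"
    assume "(\<Phi>, \<Psi>) \<in> frame_equiv N" "(\<Psi>, X) \<in> frame_equiv N"
    then obtain V W where "\<Phi> \<in> harmonic_frames N" "X \<in> harmonic_frames N"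
      "unitary_matrix V" "\<Phi> = (\<lambda>v. V *v v) ` \<Psi>" "unitary_matrix W" "\<Psi> = (\<lambda>v. W *v v) ` X"
      by (auto simp: frame_equiv_def)
    moreover from this have "\<Phi> = (\<lambda>v. (V ** W) *v v) ` X"
      by (simp add: image_image matrix_vector_mul_assoc)
    ultimately show "(\<Phi>, X) \<in> frame_equiv N"
      using unitary_matrix_mult unfolding frame_equiv_def by blast
  qed
qed

end

theory Submission
  imports Defs "HOL-Algebra.Multiplicative_Group"
begin

text \<open>
  In a group of prime order \<open>N\<close>, at most one of the \<open>d > 1\<close> distinct characters is trivial, and a
  nontrivial one maps some \<open>g\<close>, necessarily a generator, to a fixed \<open>N\<close>-th root of unity
  \<open>z \<noteq> 1\<close>. Hence each frame is unitarily equivalent to the set of powers of a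
  vector of \<open>N\<close>-th roots of unity having at least one coordinate equal to \<open>z\<close>, and there are at
  most \<open>d * N ^ (d - 1)\<close> such vectors.
\<close>

text \<open>By Lagrange the order of \<open>x\<close> divides the prime and is not 1, so the
  subgroup generated by \<open>x\<close> fills the group.\<close>

lemma (in group) exists_pow_of_order_prime:
  assumes "prime (order G)" "x \<in> carrier G" "x \<noteq> \<one>" "y \<in> carrier G"
  shows "\<exists>k::nat. y = x [^] k"
proof -
  have fin: "finite (carrier G)"
    using assms(1) by (metis order_gt_0_iff_finite prime_gt_0_nat)
  have "ord x \<noteq> 1"
    using assms(2,3) ord_eq_1 by blast
  then have ord: "ord x = order G"
    using ord_dvd_group_order[OF assms(2)] assms(1) by (auto simp: prime_nat_iff)
  have "card (generate G {x}) = order G"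
    using ord generate_pow_card[OF assms(2)] by simp
  moreover have "generate G {x} \<subseteq> carrier G"
    using assms(2) by (intro generate_incl) auto
  ultimately have "generate G {x} = carrier G"
    using fin by (simp add: card_subset_eq order_def)
  \<comment> \<open>Nonzero order lets natural exponents describe the generated subgroup.\<close>
  moreover have "ord x \<noteq> 0"
    using ord assms(1) by auto
  ultimately show ?thesis
    using generate_pow_nat[OF assms(2)] assms(4) by auto
qed

context group
begin

lemma character_mult:
  assumes "c \<in> characters G" "x \<in> carrier G" "y \<in> carrier G"
  shows "c (x \<otimes> y) = c x * c y"
  using assms by (auto simp: characters_def hom_def complex_units_def)

lemma character_nonzero:
  assumes "c \<in> characters G" "x \<in> carrier G"
  shows "c x \<noteq> 0"
  using assms by (auto simp: characters_def hom_def complex_units_def Pi_iff)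

lemma character_one:
  assumes "c \<in> characters G"
  shows "c \<one> = 1"
  using character_mult[OF assms, of \<one> \<one>] character_nonzero[OF assms, of \<one>] by simp

lemma character_pow:
  fixes n :: nat
  assumes "c \<in> characters G" "x \<in> carrier G"
  shows "c (x [^] n) = c x ^ n"
  by (induction n) (simp_all add: assms character_one character_mult)

lemma character_pow_order:
  assumes "c \<in> characters G" "x \<in> carrier G"
  shows "c x ^ order G = 1"
  using assms by (simp add: pow_order_eq_1 character_one flip: character_pow)

text \<open>Used in contrapositive form: of two distinct characters, at least one is
  nontrivial.\<close>

lemma trivial_character_unique:
  assumes "c \<in> characters G" "c' \<in> characters G"
    and "\<And>x. x \<in> carrier G \<Longrightarrow> c x = 1" "\<And>x. x \<in> carrier G \<Longrightarrow> c' x = 1"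
  shows "c = c'"
  using assms by (auto simp: characters_def intro: extensionalityI)

text \<open>A kernel element other than the identity would generate the group and force
  \<open>c y = 1\<close>, so \<open>c\<close> is injective. Its values are among the
  \<open>order G\<close> many roots of unity, so counting gives surjectivity.\<close>

lemma nontrivial_character_bij:
  assumes "prime (order G)" "c \<in> characters G" "y \<in> carrier G" "c y \<noteq> 1"
  shows "bij_betw c (carrier G) {z. z ^ order G = 1}"
proof -
  have pos: "order G > 0"
    using assms(1) by (rule prime_gt_0_nat)
  have ker: "x = \<one>" if x: "x \<in> carrier G" "c x = 1" for x
  proof (rule ccontr)
    assume "x \<noteq> \<one>"
    then obtain k :: nat where "y = x [^] k"
      using exists_pow_of_order_prime[OF assms(1) x(1) _ assms(3)] by blast
    with assms(2,4) x show False by (simp add: character_pow)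
  qed
  have inj: "inj_on c (carrier G)"
  proof (rule inj_onI)
    fix a b assume ab: "a \<in> carrier G" "b \<in> carrier G" "c a = c b"
    have "c (a \<otimes> inv b) = c (b \<otimes> inv b)"
      using ab by (simp add: character_mult[OF assms(2)] del: r_inv Units_r_inv)
    then have "a \<otimes> inv b = \<one>"
      using ab assms(2) by (intro ker) (simp_all add: character_one)
    then show "a = b"
      using ab by (metis inv_equality inv_inv inv_closed)
  qed
  moreover have "c ` carrier G = {z. z ^ order G = 1}"
  proof (rule card_subset_eq)
    show "finite {z::complex. z ^ order G = 1}"
      using pos by (intro finite_roots_unity) auto
    show "c ` carrier G \<subseteq> {z. z ^ order G = 1}"
      using assms(2) by (auto simp: character_pow_order)
    show "card (c ` carrier G) = card {z::complex. z ^ order G = 1}"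
      using inj pos by (simp add: card_image card_roots_unity_eq order_def)
  qed
  ultimately show ?thesis by (simp add: bij_betw_def)
qed

end

text \<open>Neither group nor characters occur here, so a single vector encodes a whole frame up to
  equivalence. For coordinates that are \<open>N\<close>-th roots of unity the exponents matter only
  modulo \<open>N\<close>.\<close>

definition power_orbit :: "complex^'d \<Rightarrow> (complex^'d) set" where
  "power_orbit w = range (\<lambda>m::nat. \<chi> i. (w $ i) ^ m)"

text \<open>The position \<open>j\<close> is left open because it depends on the frame which of its
  characters is nontrivial.\<close>

definition normalized_vectors :: "nat \<Rightarrow> complex \<Rightarrow> (complex^'d) set" where
  "normalized_vectors N z = {w. (\<forall>i. (w $ i) ^ N = 1) \<and> (\<exists>j. w $ j = z)}"

text \<open>Once the position of \<open>z\<close> is chosen, the other coordinates have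
  \<open>N\<close> values each; the union bound over positions gives the factor
  \<open>CARD('d)\<close>.\<close>

lemma finite_card_normalized_vectors:
  assumes "N > 0"
  shows "finite (normalized_vectors N z :: (complex^'d) set)"
    and "card (normalized_vectors N z :: (complex^'d) set) \<le> CARD('d) * N ^ (CARD('d) - 1)"
proof -
  define R where "R = {u::complex. u ^ N = 1}"
  define T where "T j = (\<lambda>i::'d. if i = j then {z} else R)" for j
  \<comment> \<open>The vectors with coordinate \<open>j\<close> pinned to \<open>z\<close>, written
    as the image of a product so that their number is bounded by the product of the factors'
    sizes.\<close>
  define A where "A j = vec_lambda ` (\<Pi>\<^sub>E i\<in>UNIV. T j i)" for j
  have R: "finite R" "card R = N"
    using assms by (auto simp: R_def card_roots_unity_eq intro: finite_roots_unity)
  have fin: "finite (A j)" for j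
    unfolding A_def using R by (intro finite_imageI finite_PiE) (auto simp: T_def)
  have card: "card (A j) \<le> N ^ (CARD('d) - 1)" for j
  proof -
    have "card (A j) \<le> card (\<Pi>\<^sub>E i\<in>UNIV. T j i)"
      unfolding A_def using R by (intro card_image_le finite_PiE) (auto simp: T_def)
    also have "\<dots> = (\<Prod>i\<in>UNIV. card (T j i))"
      by (simp add: card_PiE)
    also have "\<dots> = card (T j j) * (\<Prod>i\<in>UNIV - {j}. card (T j i))"
      by (rule prod.remove) auto
    also have "(\<Prod>i\<in>UNIV - {j}. card (T j i)) = (\<Prod>i\<in>UNIV - {j}. N)"
      by (rule prod.cong) (auto simp: T_def R)
    finally show ?thesis by (simp add: T_def)
  qed
  have sub: "normalized_vectors N z \<subseteq> (\<Union>j. A j)"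
  proof
    fix w :: "complex^'d" assume "w \<in> normalized_vectors N z"
    then obtain j where "\<And>i. (w $ i) ^ N = 1" "w $ j = z"
      by (auto simp: normalized_vectors_def)
    then have "vec_nth w \<in> (\<Pi>\<^sub>E i\<in>UNIV. T j i)"
      by (auto simp: T_def R_def)
    then have "vec_lambda (vec_nth w) \<in> A j"
      unfolding A_def by (rule imageI)
    then show "w \<in> (\<Union>j. A j)" by auto
  qed
  show "finite (normalized_vectors N z :: (complex^'d) set)"
    using sub by (rule finite_subset) (simp add: fin)
  have "card (normalized_vectors N z :: (complex^'d) set) \<le> card (\<Union>j. A j)"
    using sub fin by (intro card_mono) auto
  also have "\<dots> \<le> (\<Sum>j\<in>UNIV. card (A j))"
    by (rule card_UN_le) simp
  also have "\<dots> \<le> CARD('d) * N ^ (CARD('d) - 1)"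
    using sum_bounded_above[of UNIV "\<lambda>j. card (A j)" "N ^ (CARD('d) - 1)"] card by simp
  finally show "card (normalized_vectors N z :: (complex^'d) set) \<le> CARD('d) * N ^ (CARD('d) - 1)" .
qed

text \<open>The root \<open>z\<close> is prescribed independently of the frame and its group. The
  freedom in choosing a generator absorbs one coordinate, which lowers the exponent in the count
  from \<open>CARD('d)\<close> by 1.\<close>

lemma harmonic_frame_equiv_power_orbit:
  fixes \<Phi> :: "(complex^'d) set"
  assumes "prime N" "CARD('d) > 1" "\<Phi> \<in> harmonic_frames N" "z ^ N = 1" "z \<noteq> 1"
  shows "\<exists>w \<in> normalized_vectors N z. (\<Phi>, power_orbit w) \<in> frame_equiv N"
proof -
  obtain G :: "nat monoid" where G: "comm_group G" "finite (carrier G)" "order G = N"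
    "harmonic_frame_of G \<Phi>"
    using assms(3) by (auto simp: harmonic_frames_def)
  interpret comm_group G by fact
  obtain J \<xi> U where J: "J \<subseteq> characters G" "card J = CARD('d)" "bij_betw \<xi> (UNIV :: 'd set) J"
    "unitary_matrix U" "\<Phi> = (\<lambda>v. U *v v) ` {(\<chi> j. \<xi> j g) | g. g \<in> carrier G}"
    using G(4) by (auto simp: harmonic_frame_of_def)
  have \<xi>: "\<xi> i \<in> characters G" for i
    using J(1,3) by (auto simp: bij_betw_def)
  obtain a b :: 'd where "a \<noteq> b"
    using assms(2) by (metis (full_types) UNIV_eq_I card_1_singleton_iff less_irrefl One_nat_def singletonI)
  then have "\<xi> a \<noteq> \<xi> b"
    using J(3) by (auto simp: bij_betw_def inj_def)
  \<comment> \<open>If every character in the enumeration were trivial, \<open>\<xi> a\<close> and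
    \<open>\<xi> b\<close> would coincide.\<close>
  then obtain j y where y: "y \<in> carrier G" "\<xi> j y \<noteq> 1"
    using trivial_character_unique[OF \<xi> \<xi>] by metis
  have "z \<in> \<xi> j ` carrier G"
    using nontrivial_character_bij[OF _ \<xi> y] assms(1,4) G(3) by (auto simp: bij_betw_def)
  then obtain g where g: "g \<in> carrier G" "\<xi> j g = z" by auto
  define w where "w = (\<chi> i. \<xi> i g)"
  \<comment> \<open>Characters send the identity to 1, whereas \<open>\<xi> j g = z\<close> differs
    from 1; hence \<open>g\<close> generates the group.\<close>
  have "g \<noteq> \<one>\<^bsub>G\<^esub>"
    using g assms(5) \<xi> by (auto simp: character_one)
  then have gen: "\<exists>k::nat. h = g [^]\<^bsub>G\<^esub> k" if "h \<in> carrier G" for h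
    using exists_pow_of_order_prime[OF _ g(1) _ that] assms(1) G(3) by auto
  have orbit: "{(\<chi> j. \<xi> j h) | h. h \<in> carrier G} = power_orbit w"
  proof
    show "{(\<chi> j. \<xi> j h) | h. h \<in> carrier G} \<subseteq> power_orbit w"
    proof clarify
      fix h assume "h \<in> carrier G"
      then obtain k :: nat where "h = g [^]\<^bsub>G\<^esub> k" using gen by blast
      then show "(\<chi> j. \<xi> j h) \<in> power_orbit w"
        using g \<xi> by (auto simp: power_orbit_def w_def character_pow)
    qed
    show "power_orbit w \<subseteq> {(\<chi> j. \<xi> j h) | h. h \<in> carrier G}"
    proof (unfold power_orbit_def, clarify)
      fix m :: nat
      show "\<exists>h. (\<chi> i. w $ i ^ m) = (\<chi> j. \<xi> j h) \<and> h \<in> carrier G"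
        using g \<xi> by (intro exI[of _ "g [^]\<^bsub>G\<^esub> m"]) (simp add: w_def character_pow)
    qed
  qed
  \<comment> \<open>\<open>frame_equiv\<close> relates only harmonic frames, so the orbit must be
    one itself: the same characters with the identity as unitary matrix. Then \<open>U\<close>
    witnesses the equivalence.\<close>
  have "harmonic_frame_of G (power_orbit w)"
    unfolding harmonic_frame_of_def using J(1-3) unitary_matrix_one
    by (intro exI[of _ J] exI[of _ \<xi>] exI[of _ "mat 1"]) (simp add: orbit)
  then have "power_orbit w \<in> harmonic_frames N"
    using G(1-3) by (auto simp: harmonic_frames_def)
  then have "(\<Phi>, power_orbit w) \<in> frame_equiv N"
    using assms(3) J(4,5) by (auto simp: frame_equiv_def orbit)
  moreover have "w \<in> normalized_vectors N z"
    using g \<xi> G(3) character_pow_order by (auto simp: normalized_vectors_def w_def)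
  ultimately show ?thesis by blast
qed

theorem corollary2p7:
  assumes "CARD('d::finite) > 1"
  shows "\<exists>C::real. \<forall>N::nat. prime N \<and> N > CARD('d) \<longrightarrow>
           finite ((harmonic_frames N :: (complex^'d) set set) // frame_equiv N) \<and>
           real (card ((harmonic_frames N :: (complex^'d) set set) // frame_equiv N))
             \<le> C * real N ^ (CARD('d) - 1)"
proof (intro exI[of _ "real CARD('d)"] allI impI)
  fix N :: nat assume N: "prime N \<and> N > CARD('d)"
  then have N1: "N > 1" by (blast intro: prime_gt_1_nat)
  then have N0: "N > 0" by simp
  \<comment> \<open>There are \<open>N > 1\<close> roots of unity, so one differs from 1. It is
    fixed before any frame is considered, so that one set \<open>?W\<close> serves all
    classes.\<close>
  have "\<not> {u::complex. u ^ N = 1} \<subseteq> {1}"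
    using card_mono[of "{1::complex}" "{u. u ^ N = 1}"] N0 N1 by (auto simp: card_roots_unity_eq)
  then obtain z :: complex where z: "z ^ N = 1" "z \<noteq> 1" by blast
  let ?Q = "(harmonic_frames N :: (complex^'d) set set) // frame_equiv N"
  let ?W = "normalized_vectors N z :: (complex^'d) set"
  \<comment> \<open>An inclusion suffices for the upper bound: different \<open>w\<close> may give
    the same class, and a \<open>w\<close> whose orbit is not a harmonic frame gives the empty
    set.\<close>
  have sub: "?Q \<subseteq> (\<lambda>w. frame_equiv N `` {power_orbit w}) ` ?W"
  proof
    fix X assume "X \<in> ?Q"
    then obtain \<Phi> where \<Phi>: "\<Phi> \<in> harmonic_frames N" "X = frame_equiv N `` {\<Phi>}"
      by (auto elim: quotientE)
    obtain w where w: "w \<in> ?W" "(\<Phi>, power_orbit w) \<in> frame_equiv N"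
      using harmonic_frame_equiv_power_orbit[OF _ assms \<Phi>(1) z] N by blast
    have "X = frame_equiv N `` {power_orbit w}"
      using equiv_class_eq[OF equiv_frame_equiv w(2)] \<Phi>(2) by simp
    then show "X \<in> (\<lambda>w. frame_equiv N `` {power_orbit w}) ` ?W"
      using w(1) by blast
  qed
  have finW: "finite ?W" and cardW: "card ?W \<le> CARD('d) * N ^ (CARD('d) - 1)"
    using finite_card_normalized_vectors[OF N0] by blast+
  have "card ?Q \<le> card ?W"
    using sub finW by (rule surj_card_le[rotated])
  then have "card ?Q \<le> CARD('d) * N ^ (CARD('d) - 1)"
    using cardW by simp
  then have "real (card ?Q) \<le> real CARD('d) * real N ^ (CARD('d) - 1)"
    by (metis of_nat_le_iff of_nat_mult of_nat_power)
  moreover have "finite ?Q"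
    using sub finW by (rule finite_surj[rotated])
  ultimately show "finite ?Q \<and> real (card ?Q) \<le> real CARD('d) * real N ^ (CARD('d) - 1)"
    by blast
qed

end
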